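(* Let $a\in\mathbb{R}$, $\lambda>0$, $\gamma\ge 0$, $\theta>0$, $\beta>0$ be constants, and put $q=q(p)=(p-a-\gamma-0.5)/\lambda$ and $\Lambda=\beta\max(\theta,1/\theta)$. Then, as $p\to\infty$: (a) $\displaystyle \frac{\lambda^{-1}\,B_4(p;a,\lambda,\gamma)^{1/p}}{g(q)}\sim 1+\Delta(q)$; (b) $F_3(p;\theta,\beta)\asymp B_4(p;0,\Lambda,0)$; (c) $F_3(p;\theta,\beta)\asymp G_3(p;\theta,\beta)$, where $p$ tends to infinity through those positive integers for which $G_3(p;\theta,\beta)>0$; (d) $D_4(p;a,\lambda,\gamma)\asymp B_4(p;a,\lambda,\gamma)$, where $p$ tends to infinity through those positive integers for which $D_4(p;a,\lambda,\gamma)>0$.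
   Context: For $\nu\ge 0$, $I_\nu(z)=2^{-\nu}z^\nu\sum_{k=0}^\infty \frac{4^{-k}z^{2k}}{k!\,\Gamma(\nu+k+1)}$ is the modified Bessel function, and $I_{-k}=I_k$ for integers $k$. For $p\ge 0$, $\theta>0$, $\beta>0$: $F_3(p;\theta,\beta)=\sum_{k=-\infty}^{\infty}|k|^p\theta^kI_k(\beta)$. For positive integers $p$: $G_3(p;\theta,\beta)=\sum_{k=-\infty}^{\infty}k^p\theta^kI_k(\beta)$. For $\lambda>0$, $\gamma\ge0$: $B_4(p;a,\lambda,\gamma)=\sum_{n=0}^\infty \frac{|n-a|^p\lambda^n}{e^{\lambda}\,\Gamma(n+\gamma+1)}$, and for positive integers $p$: $D_4(p;a,\lambda,\gamma)=\sum_{n=0}^\infty \frac{(n-a)^p\lambda^n}{e^{\lambda}\,\Gamma(n+\gamma+1)}$. For $p\ge 4$: $g(p)=\frac{p}{e\log p}$ and $\Delta(p)=\frac{\log\log p}{\log p}$. For two positive functions $f_1,f_2$ of $p$: $f_1\sim f_2$ means $f_1(p)=f_2(p)(1+O(1/\log p))$ as $p\to\infty$; and $f_1\asymp f_2$ means $f_1(p)^{1/p}/g(q)\sim f_2(p)^{1/p}/g(q)$, i.e. $f_1(p)^{1/p}=f_2(p)^{1/p}(1+O(1/\log p))$. The constants in $O(\cdot)$ may depend on the fixed parameters $a,\lambda,\gamma,\theta,\beta$. *)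

theory Defs
  imports "HOL-Analysis.Analysis" "HOL-Library.Landau_Symbols"
begin

(* For arguments z > 0; z powr 0 is not the usual value 1 at z = 0. *)
definition bessel_I :: "real \<Rightarrow> real \<Rightarrow> real" where
  "bessel_I \<nu> z =
     2 powr (- \<nu>) * z powr \<nu> *
       (\<Sum>k. z ^ (2 * k) / (4 ^ k * (fact k * Gamma (\<nu> + real k + 1))))"

(* Order in the integers, by the convention that orders k and -k give the same function. *)
definition bessel_I_int :: "int \<Rightarrow> real \<Rightarrow> real" where
  "bessel_I_int k z = bessel_I \<bar>real_of_int k\<bar> z"

(* Real exponents p are meant to be positive in F3 and B4: 0 powr 0 = 0 affects only p = 0. *)
definition F3 :: "real \<Rightarrow> real \<Rightarrow> real \<Rightarrow> real" where
  "F3 p \<theta> \<beta> = (\<Sum>\<^sub>\<infinity>k\<in>UNIV. \<bar>real_of_int k\<bar> powr p * \<theta> powi k * bessel_I_int k \<beta>)"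

definition G3 :: "nat \<Rightarrow> real \<Rightarrow> real \<Rightarrow> real" where
  "G3 p \<theta> \<beta> = (\<Sum>\<^sub>\<infinity>k\<in>UNIV. real_of_int k ^ p * \<theta> powi k * bessel_I_int k \<beta>)"

definition B4 :: "real \<Rightarrow> real \<Rightarrow> real \<Rightarrow> real \<Rightarrow> real" where
  "B4 p a lam \<gamma> =
     (\<Sum>n. \<bar>real n - a\<bar> powr p * lam ^ n / (exp lam * Gamma (real n + \<gamma> + 1)))"

definition D4 :: "nat \<Rightarrow> real \<Rightarrow> real \<Rightarrow> real \<Rightarrow> real" where
  "D4 p a lam \<gamma> =
     (\<Sum>n. (real n - a) ^ p * lam ^ n / (exp lam * Gamma (real n + \<gamma> + 1)))"

(* Both functions are meant for p \<ge> 4. *)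
definition g :: "real \<Rightarrow> real" where
  "g p = p / (exp 1 * ln p)"

definition Delta :: "real \<Rightarrow> real" where
  "Delta p = ln (ln p) / ln p"

(* f1 = f2 * (1 + O(1 / log p)) along the filter F. The variable ranges over an arbitrary
   type, with v giving its real value p, so that p can be real (v = id) or a natural number
   restricted to a subset (v = real). *)
definition log_sim :: "'a filter \<Rightarrow> ('a \<Rightarrow> real) \<Rightarrow> ('a \<Rightarrow> real) \<Rightarrow> ('a \<Rightarrow> real) \<Rightarrow> bool" where
  "log_sim F v f1 f2 \<longleftrightarrow>
     (\<exists>h. h \<in> O[F](\<lambda>x. 1 / ln (v x)) \<and> (\<forall>\<^sub>F x in F. f1 x = f2 x * (1 + h x)))"

(* Dividing both sides by a common normalising factor, nonzero for large p, would not change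
   this relation. *)
definition log_asymp :: "'a filter \<Rightarrow> ('a \<Rightarrow> real) \<Rightarrow> ('a \<Rightarrow> real) \<Rightarrow> ('a \<Rightarrow> real) \<Rightarrow> bool" where
  "log_asymp F v f1 f2 \<longleftrightarrow>
     log_sim F v (\<lambda>x. f1 x powr (1 / v x)) (\<lambda>x. f2 x powr (1 / v x))"

definition tends_through :: "nat set \<Rightarrow> nat filter" where
  "tends_through S = inf sequentially (principal S)"

end

(* All the functions share one growth rate, whatever the parameters: the p-th root of each is
   exp (log_rate p + O(1 / ln p)), so every claimed ratio is exp (O(1 / ln p)) = 1 + O(1 / ln p).
   Upper bound: x^p <= (p / (e t))^p exp(t x) for all t > 0 turns the series into an exponential
   series with sum exp(lam e^t); take e^t = p / ln p. Lower bound: keep only the term of index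
   n = ceiling(p / ln p).
   For odd p, G3 is symmetrised over k and -k: its terms all have the sign of theta - 1, so
   positivity of G3 forces theta > 1, and one term suffices again. In D4 the terms with n < a
   contribute at most a constant times |a|^p, which is negligible. *)
theory Submission
  imports Defs "HOL-Real_Asymp.Real_Asymp"
begin

section \<open>The common growth rate\<close>

text \<open>A relative error O(1 / ln p) in the p-th root is an error O(p / ln p) in the exponent,
  and this tolerance shapes every estimate. With n of order p / ln p, the factors lam^n, theta^n and
  (beta / 2)^n are all exp (O(p / ln p)), so these bases, like constant factors, cannot be seen; a
  bounded shift of n inside the p-th power costs only exp (O(ln p)). Hence F3, whose natural base is
  max (theta, 1 / theta) * beta / 2, can be compared with B4 at Lambda, which is twice that base.
  What has to be kept is exact: at n = p / ln p one has p ln n - n ln n = p *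
  \<open>log_rate p\<close>. This n comes from a saddle point: (p / (e t))^p exp (lam e^t) is
  stationary where t e^t = p / lam, and p / ln p agrees with the resulting e^t up to a bounded
  factor. Taking t = ln p itself would be too crude, since lam e^t would then be of order p.\<close>

text \<open>This is \<open>ln (g p) + Delta p\<close>.\<close>
definition log_rate :: "real \<Rightarrow> real" where
  "log_rate p = ln p - 1 - ln (ln p) + ln (ln p) / ln p"

text \<open>The two sides are kept apart so that each passes along an inequality between functions.
  Writing the bounds without logarithms or p-th roots lets them make sense before \<open>f\<close>
  is known to be positive, as with \<open>G3\<close> and \<open>D4\<close>. The pair
  \<open>F\<close>, \<open>v\<close> serves real exponents and integers from a subset alike.\<close>

definition rate_le :: "'a filter \<Rightarrow> ('a \<Rightarrow> real) \<Rightarrow> ('a \<Rightarrow> real) \<Rightarrow> bool" where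
  "rate_le F v f \<longleftrightarrow> (\<exists>C. \<forall>\<^sub>F x in F. f x \<le> exp (v x * (log_rate (v x) + C / ln (v x))))"

definition rate_ge :: "'a filter \<Rightarrow> ('a \<Rightarrow> real) \<Rightarrow> ('a \<Rightarrow> real) \<Rightarrow> bool" where
  "rate_ge F v f \<longleftrightarrow> (\<exists>C. \<forall>\<^sub>F x in F. exp (v x * (log_rate (v x) - C / ln (v x))) \<le> f x)"

text \<open>This separates an estimate of \<open>f\<close> by an explicit exponent \<open>h\<close>
  from the asymptotic comparison of \<open>h\<close>, which involves elementary functions
  only.\<close>

lemma rate_leI:
  assumes "(\<lambda>p. h p - p * log_rate p) \<in> O(\<lambda>p. p / ln p)"
    and "\<forall>\<^sub>F p in at_top. f p \<le> exp (h p)"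
  shows "rate_le at_top (\<lambda>p. p) f"
proof -
  obtain C where "\<forall>\<^sub>F p in at_top. norm (h p - p * log_rate p) \<le> C * norm (p / ln p)"
    using assms(1) by (elim landau_o.bigE)
  moreover have "\<forall>\<^sub>F p::real in at_top. 1 < p" by (rule eventually_gt_at_top)
  ultimately have "\<forall>\<^sub>F p in at_top. f p \<le> exp (p * (log_rate p + C / ln p))"
    using assms(2)
  proof eventually_elim
    case (elim p)
    have "ln p > 0" using elim by simp
    then have "h p - p * log_rate p \<le> C * (p / ln p)" using elim by (simp add: abs_le_iff)
    then have "h p \<le> p * (log_rate p + C / ln p)" by (simp add: algebra_simps)
    with elim(3) show ?case by (meson exp_le_cancel_iff order_trans)
  qed
  then show ?thesis unfolding rate_le_def by blast
qed

lemma rate_geI: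
  assumes "(\<lambda>p. h p - p * log_rate p) \<in> O(\<lambda>p. p / ln p)"
    and "\<forall>\<^sub>F p in at_top. exp (h p) \<le> f p"
  shows "rate_ge at_top (\<lambda>p. p) f"
proof -
  obtain C where "\<forall>\<^sub>F p in at_top. norm (h p - p * log_rate p) \<le> C * norm (p / ln p)"
    using assms(1) by (elim landau_o.bigE)
  moreover have "\<forall>\<^sub>F p::real in at_top. 1 < p" by (rule eventually_gt_at_top)
  ultimately have "\<forall>\<^sub>F p in at_top. exp (p * (log_rate p - C / ln p)) \<le> f p"
    using assms(2)
  proof eventually_elim
    case (elim p)
    have "ln p > 0" using elim by simp
    then have "- (C * (p / ln p)) \<le> h p - p * log_rate p" using elim by (simp add: abs_le_iff)
    then have "p * (log_rate p - C / ln p) \<le> h p" by (simp add: algebra_simps)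
    with elim(3) show ?case by (meson exp_le_cancel_iff order_trans)
  qed
  then show ?thesis unfolding rate_ge_def by blast
qed

lemma rate_le_mono:
  assumes "rate_le F v f" and "\<forall>\<^sub>F x in F. f' x \<le> f x"
  shows "rate_le F v f'"
proof -
  obtain C where "\<forall>\<^sub>F x in F. f x \<le> exp (v x * (log_rate (v x) + C / ln (v x)))"
    using assms(1) unfolding rate_le_def by blast
  then have "\<forall>\<^sub>F x in F. f' x \<le> exp (v x * (log_rate (v x) + C / ln (v x)))"
    using assms(2) by eventually_elim (rule order_trans)
  then show ?thesis unfolding rate_le_def by blast
qed

lemma rate_ge_mono:
  assumes "rate_ge F v f" and "\<forall>\<^sub>F x in F. f x \<le> f' x"
  shows "rate_ge F v f'"
proof -
  obtain C where "\<forall>\<^sub>F x in F. exp (v x * (log_rate (v x) - C / ln (v x))) \<le> f x"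
    using assms(1) unfolding rate_ge_def by blast
  then have "\<forall>\<^sub>F x in F. exp (v x * (log_rate (v x) - C / ln (v x))) \<le> f' x"
    using assms(2) by eventually_elim (rule order_trans)
  then show ?thesis unfolding rate_ge_def by blast
qed

lemma rate_le_compose:
  assumes "rate_le at_top (\<lambda>p. p) f" and "filterlim v at_top F"
  shows "rate_le F v (\<lambda>x. f (v x))"
  using assms(1) eventually_compose_filterlim[OF _ assms(2)] unfolding rate_le_def by blast

lemma rate_ge_compose:
  assumes "rate_ge at_top (\<lambda>p. p) f" and "filterlim v at_top F"
  shows "rate_ge F v (\<lambda>x. f (v x))"
  using assms(1) eventually_compose_filterlim[OF _ assms(2)] unfolding rate_ge_def by blast

section \<open>From two-sided exponential bounds to relative errors\<close>

lemma rate_ge_pos: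
  assumes "rate_ge F v f"
  shows "\<forall>\<^sub>F x in F. 0 < f x"
proof -
  obtain C where "\<forall>\<^sub>F x in F. exp (v x * (log_rate (v x) - C / ln (v x))) \<le> f x"
    using assms(1) unfolding rate_ge_def by blast
  then show ?thesis by eventually_elim (meson exp_gt_zero less_le_trans)
qed

lemma rate_bigo:
  assumes "rate_le F v f" and "rate_ge F v f" and "filterlim v at_top F"
  shows "(\<lambda>x. ln (f x) / v x - log_rate (v x)) \<in> O[F](\<lambda>x. 1 / ln (v x))"
proof -
  obtain C where C: "\<forall>\<^sub>F x in F. f x \<le> exp (v x * (log_rate (v x) + C / ln (v x)))"
    using assms(1) unfolding rate_le_def by blast
  obtain D where D: "\<forall>\<^sub>F x in F. exp (v x * (log_rate (v x) - D / ln (v x))) \<le> f x"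
    using assms(2) unfolding rate_ge_def by blast
  have "\<forall>\<^sub>F x in F. 1 < v x"
    using eventually_compose_filterlim[OF eventually_gt_at_top assms(3)] .
  with C D rate_ge_pos[OF assms(2)]
  have "\<forall>\<^sub>F x in F. norm (ln (f x) / v x - log_rate (v x)) \<le> max C D * norm (1 / ln (v x))"
  proof eventually_elim
    case (elim x)
    have l: "ln (v x) > 0" using elim by simp
    have "ln (f x) \<le> v x * (log_rate (v x) + C / ln (v x))"
      using elim by (metis ln_exp ln_mono)
    then have 1: "ln (f x) / v x - log_rate (v x) \<le> C / ln (v x)"
      using elim by (simp add: pos_divide_le_eq algebra_simps)
    have "v x * (log_rate (v x) - D / ln (v x)) \<le> ln (f x)"
      using elim by (simp add: ln_ge_iff)
    then have "log_rate (v x) - D / ln (v x) \<le> ln (f x) / v x"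
      using elim by (simp add: pos_le_divide_eq mult.commute)
    then have 2: "- (D / ln (v x)) \<le> ln (f x) / v x - log_rate (v x)" by simp
    have "C / ln (v x) \<le> max C D / ln (v x)" "D / ln (v x) \<le> max C D / ln (v x)"
      using l by (auto intro!: divide_right_mono)
    with 1 2 l show ?case by (simp add: abs_le_iff)
  qed
  then show ?thesis by (rule bigoI)
qed

text \<open>From exp (-u) >= 1 - u comes exp u * (1 - u) <= 1. As 1 - u >= 1/2, this gives exp u <=
  2, and rearranged it gives exp u - 1 <= u exp u; the other side is exp u >= 1 + u.\<close>

lemma abs_exp_minus_one_le:
  fixes u :: real
  assumes "\<bar>u\<bar> \<le> 1 / 2"
  shows "\<bar>exp u - 1\<bar> \<le> 2 * \<bar>u\<bar>"
proof -
  have 1: "1 + u \<le> exp u" by (rule exp_ge_add_one_self)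
  have "1 - u \<le> exp (- u)" using exp_ge_add_one_self[of "- u"] by simp
  then have "exp u * (1 - u) \<le> 1"
    by (metis exp_gt_zero exp_minus_inverse less_imp_le mult_left_mono)
  moreover have "exp u * (1 / 2) \<le> exp u * (1 - u)"
    using assms by (intro mult_left_mono) auto
  ultimately have "exp u \<le> 2" by linarith
  then have "exp u * \<bar>u\<bar> \<le> 2 * \<bar>u\<bar>" by (intro mult_right_mono) auto
  moreover have "exp u * u \<le> exp u * \<bar>u\<bar>" by (intro mult_left_mono) auto
  ultimately have "exp u * u \<le> 2 * \<bar>u\<bar>" by linarith
  moreover have "exp u - exp u * u \<le> 1"
    using \<open>exp u * (1 - u) \<le> 1\<close> by (simp add: right_diff_distrib)
  ultimately show ?thesis using 1 by linarith
qed

lemma log_simI: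
  assumes "\<forall>\<^sub>F x in F. 0 < f1 x" and "\<forall>\<^sub>F x in F. 0 < f2 x"
    and bigo: "(\<lambda>x. ln (f1 x) - ln (f2 x)) \<in> O[F](\<lambda>x. 1 / ln (v x))"
    and v: "filterlim v at_top F"
  shows "log_sim F v f1 f2"
proof -
  define h where "h x = f1 x / f2 x - 1" for x
  obtain c where c: "c > 0"
    "\<forall>\<^sub>F x in F. norm (ln (f1 x) - ln (f2 x)) \<le> c * norm (1 / ln (v x))"
    using bigo by (elim landau_o.bigE)
  have "\<forall>\<^sub>F p in at_top. 2 * c \<le> ln (p::real)" by real_asymp
  from eventually_compose_filterlim[OF this v] have "\<forall>\<^sub>F x in F. 2 * c \<le> ln (v x)" .
  with c(2) assms(1,2) have "\<forall>\<^sub>F x in F. norm (h x) \<le> 2 * c * norm (1 / ln (v x))"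
  proof eventually_elim
    case (elim x)
    define u where "u = ln (f1 x) - ln (f2 x)"
    have h: "h x = exp u - 1" using elim by (simp add: u_def h_def exp_diff)
    have l: "0 < ln (v x)" using elim(4) c(1) by linarith
    have u: "\<bar>u\<bar> \<le> c / ln (v x)" using elim(1) l by (simp add: u_def)
    \<comment> \<open>This is what the threshold \<open>2 * c\<close> for \<open>ln (v x)\<close>
      was chosen for.\<close>
    also have "\<dots> \<le> 1 / 2" using elim l by (simp add: pos_divide_le_eq)
    finally have "\<bar>h x\<bar> \<le> 2 * \<bar>u\<bar>" unfolding h by (rule abs_exp_minus_one_le)
    with u l show ?case by simp
  qed
  then have "h \<in> O[F](\<lambda>x. 1 / ln (v x))" by (rule bigoI)
  moreover have "\<forall>\<^sub>F x in F. f1 x = f2 x * (1 + h x)"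
    using assms(2) by eventually_elim (simp add: h_def)
  ultimately show ?thesis unfolding log_sim_def by blast
qed

text \<open>The logarithm of a p-th root is \<open>ln (f x) / v x\<close>, and the common
  \<open>log_rate\<close> cancels in the difference of two such logarithms. The lower bounds also
  supply the positivity without which \<open>ln\<close> and \<open>powr\<close> would return default
  values.\<close>

lemma log_asympI:
  assumes "rate_le F v f1" "rate_ge F v f1" "rate_le F v f2" "rate_ge F v f2"
    and v: "filterlim v at_top F"
  shows "log_asymp F v f1 f2"
proof -
  have "(\<lambda>x. (ln (f1 x) / v x - log_rate (v x)) - (ln (f2 x) / v x - log_rate (v x)))
      \<in> O[F](\<lambda>x. 1 / ln (v x))"
    using assms by (intro sum_in_bigo rate_bigo)
  also have "?this \<longleftrightarrow> (\<lambda>x. ln (f1 x powr (1 / v x)) - ln (f2 x powr (1 / v x)))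
      \<in> O[F](\<lambda>x. 1 / ln (v x))"
    using rate_ge_pos[OF assms(2)] rate_ge_pos[OF assms(4)]
    by (intro landau_o.big.in_cong) (eventually_elim, simp add: ln_powr)
  finally show ?thesis unfolding log_asymp_def
    using rate_ge_pos[OF assms(2)] rate_ge_pos[OF assms(4)] v
    by (intro log_simI) (auto elim: eventually_mono)
qed

section \<open>Moments of Poisson type\<close>

text \<open>The function x^p exp (-t x) is largest at x = p / t. The inequality is ln y <= y - 1 at
  y = t x / p, multiplied by p.\<close>

lemma powr_le_exp:
  fixes x p t :: real
  assumes "x \<ge> 0" "p > 0" "t > 0"
  shows "x powr p \<le> (p / (exp 1 * t)) powr p * exp (t * x)"
proof (cases "x = 0")
  case False
  then have x: "x > 0" using assms by simp
  have "ln (t * x / p) \<le> t * x / p - 1" using x assms by (intro ln_le_minus_one) simp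
  then have "p * ln (t * x / p) \<le> p * (t * x / p - 1)" using assms by (intro mult_left_mono) auto
  also have "\<dots> = t * x - p" using assms by (simp add: field_simps)
  finally have "p * ln x \<le> p * ln (p / (exp 1 * t)) + t * x"
    using x assms by (simp add: ln_mult ln_div algebra_simps)
  then have "exp (p * ln x) \<le> exp (p * ln (p / (exp 1 * t)) + t * x)" by simp
  with x assms show ?thesis by (simp add: powr_def exp_add)
qed (use assms in simp)

text \<open>Up to the factor \<open>exp lam\<close>, the p-th moment of N + A for a Poisson variable
  N of mean \<open>lam\<close>. The shift \<open>A\<close> absorbs the centre \<open>a\<close> of
  \<open>B4\<close>.\<close>

definition poisson_moment :: "real \<Rightarrow> real \<Rightarrow> real \<Rightarrow> real" where
  "poisson_moment p A lam = (\<Sum>n. (real n + A) powr p * lam ^ n / fact n)"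

lemma poisson_moment_bound:
  fixes A p t lam :: real
  assumes "A \<ge> 0" "p > 0" "t > 0" "lam > 0"
  shows "summable (\<lambda>n. (real n + A) powr p * lam ^ n / fact n)" (is ?S)
    and "poisson_moment p A lam \<le> (p / (exp 1 * t)) powr p * exp (A * t) * exp (lam * exp t)" (is ?B)
proof -
  define c where "c = (p / (exp 1 * t)) powr p * exp (A * t)"
  have sums: "(\<lambda>n. c * ((lam * exp t) ^ n /\<^sub>R fact n)) sums (c * exp (lam * exp t))"
    by (intro sums_mult exp_converges)
  have le: "(real n + A) powr p * lam ^ n / fact n \<le> c * ((lam * exp t) ^ n /\<^sub>R fact n)" for n
  proof -
    have "(real n + A) powr p \<le> (p / (exp 1 * t)) powr p * exp (t * (real n + A))"
      using assms by (intro powr_le_exp) auto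
    also have "\<dots> = c * exp t ^ n"
      by (simp add: c_def exp_add[symmetric] exp_of_nat_mult[symmetric] algebra_simps)
    finally have "(real n + A) powr p * (lam ^ n / fact n) \<le> c * exp t ^ n * (lam ^ n / fact n)"
      using assms by (intro mult_right_mono) auto
    then show ?thesis by (simp add: power_mult_distrib field_simps)
  qed
  show ?S using assms
    by (intro summable_comparison_test'[OF sums_summable[OF sums], of 0]) (use le in auto)
  then show ?B unfolding poisson_moment_def
    using suminf_le[OF le _ sums_summable[OF sums]] sums_unique[OF sums] by (simp add: c_def)
qed

text \<open>With t = ln (p / ln p) = ln p - ln (ln p), the term lam e^t is within the tolerance O(p
  / ln p), while ln t = ln (ln p) - ln (ln p) / ln p + o(1 / ln p). The second term of this
  expansion is the source of \<open>Delta\<close> in the upper bound.\<close>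

lemma rate_le_poisson_moment:
  fixes A K lam :: real
  assumes "A > 0" "K > 0" "lam > 0"
  shows "rate_le at_top (\<lambda>p. p) (\<lambda>p. K * poisson_moment p A lam)"
proof (rule rate_leI)
  show "(\<lambda>p. ln K + p * (ln p - 1 - ln (ln (p / ln p))) + A * ln (p / ln p) + lam * (p / ln p)
      - p * log_rate p) \<in> O(\<lambda>p. p / ln p)"
    unfolding log_rate_def using assms by real_asymp
  have "\<forall>\<^sub>F p in at_top. 0 < ln (p / ln (p::real))" by real_asymp
  then show "\<forall>\<^sub>F p in at_top. K * poisson_moment p A lam
      \<le> exp (ln K + p * (ln p - 1 - ln (ln (p / ln p))) + A * ln (p / ln p) + lam * (p / ln p))"
    using eventually_gt_at_top[of "1::real"]
  proof eventually_elim
    case (elim p)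
    define t where "t = ln (p / ln p)"
    have t: "t > 0" "exp t = p / ln p" using elim by (auto simp: t_def)
    have "K * poisson_moment p A lam
        \<le> K * ((p / (exp 1 * t)) powr p * exp (A * t) * exp (lam * exp t))"
      using assms elim t by (intro mult_left_mono poisson_moment_bound(2)) auto
    also have "\<dots> = exp (ln K + p * (ln p - 1 - ln t) + A * t + lam * exp t)"
      using assms elim t by (simp add: exp_add exp_diff powr_def ln_div ln_mult algebra_simps)
    finally show ?case using t by (simp add: t_def)
  qed
qed

text \<open>Both bounds are inductions on Gamma (x + 1) = x Gamma x. The first reduces the series
  for general \<gamma> to Poisson moments; the second bounds the denominator of the peak term
  without Stirling's formula.\<close>

lemma Gamma_add_Suc_of_nat:
  fixes \<gamma> :: real
  assumes "\<gamma> \<ge> 0"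
  shows "Gamma (\<gamma> + 1) * fact n \<le> Gamma (real n + \<gamma> + 1)"
    and "Gamma (real n + \<gamma> + 1) \<le> Gamma (\<gamma> + 1) * (real n + \<gamma>) ^ n"
proof -
  have G: "Gamma (real (Suc n) + \<gamma> + 1) = (real (Suc n) + \<gamma>) * Gamma (real n + \<gamma> + 1)" for n
  proof -
    have "real n + \<gamma> + 1 \<notin> \<int>\<^sub>\<le>\<^sub>0" using assms by (auto dest!: nonpos_Ints_nonpos)
    from Gamma_plus1[OF this] show ?thesis by (simp add: add_ac)
  qed
  have pos: "Gamma (real n + \<gamma> + 1) > 0" for n using assms by (intro Gamma_real_pos) auto
  show "Gamma (\<gamma> + 1) * fact n \<le> Gamma (real n + \<gamma> + 1)"
  proof (induction n)
    case (Suc n)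
    have "real (Suc n) * (Gamma (\<gamma> + 1) * fact n) \<le> (real (Suc n) + \<gamma>) * Gamma (real n + \<gamma> + 1)"
      using Suc assms pos[of 0] by (intro mult_mono) auto
    then show ?case unfolding G by (simp add: algebra_simps)
  qed simp
  show "Gamma (real n + \<gamma> + 1) \<le> Gamma (\<gamma> + 1) * (real n + \<gamma>) ^ n"
  proof (induction n)
    case (Suc n)
    have "(real (Suc n) + \<gamma>) * Gamma (real n + \<gamma> + 1)
        \<le> (real (Suc n) + \<gamma>) * (Gamma (\<gamma> + 1) * (real n + \<gamma>) ^ n)"
      using Suc assms by (intro mult_left_mono) auto
    also have "\<dots> \<le> (real (Suc n) + \<gamma>) * (Gamma (\<gamma> + 1) * (real (Suc n) + \<gamma>) ^ n)"
      using assms pos[of 0] by (intro mult_left_mono power_mono) auto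
    finally show ?case unfolding G by (simp add: algebra_simps)
  qed simp
qed

text \<open>The largest term of a Poisson-type series has an index asymptotic to \<open>p / ln p\<close>; this single
  term already gives the lower bound to the required precision. The factor \<open>n ^ n\<close> is a sufficient
  bound for \<open>n!\<close>, since the lost factor \<open>exp n\<close> is only \<open>exp (O(p / ln p))\<close>.\<close>

definition peak :: "real \<Rightarrow> nat" where
  "peak p = nat \<lceil>p / ln p\<rceil>"

lemma peak_bounds:
  assumes "p > 1"
  shows "p / ln p \<le> real (peak p)" "real (peak p) \<le> p / ln p + 1"
proof -
  have "p / ln p \<ge> 0" using assms by simp
  then show "p / ln p \<le> real (peak p)" "real (peak p) \<le> p / ln p + 1"
    unfolding peak_def by linarith+
qed

lemma peak_at_top: "filterlim (\<lambda>p. real (peak p)) at_top at_top"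
proof (rule filterlim_at_top_mono)
  show "filterlim (\<lambda>p::real. p / ln p) at_top at_top" by real_asymp
  show "\<forall>\<^sub>F p in at_top. p / ln p \<le> real (peak p)"
    using eventually_gt_at_top[of 1] by eventually_elim (rule peak_bounds)
qed

text \<open>The main part p ln n - n ln n gives the rate; \<open>K\<close>, \<open>A\<close>,
  \<open>lam\<close>, \<gamma> and the rounding of n only enter the error. Subtracting a positive
  \<open>A\<close> lets one statement bound |n - a| from below for every \<open>a\<close>.\<close>

lemma rate_ge_peak_term:
  fixes A K lam \<gamma> :: real
  assumes "A > 0" "K > 0" "lam > 0" "\<gamma> \<ge> 0"
  shows "rate_ge at_top (\<lambda>p. p)
    (\<lambda>p. K * ((real (peak p) - A) powr p * lam ^ peak p / Gamma (real (peak p) + \<gamma> + 1)))"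
proof (rule rate_geI)
  \<comment> \<open>The sign of \<open>ln lam\<close> is unknown, so its absolute value is used;
    adding 1 makes \<open>B\<close> strictly positive.\<close>
  define B where "B = \<bar>ln lam\<bar> + 1"
  define k where "k = ln K - ln (Gamma (\<gamma> + 1))"
  have G0: "Gamma (\<gamma> + 1) > 0" using assms by (intro Gamma_real_pos) auto
  have "B > 0" "\<gamma> + 1 > 0" unfolding B_def using assms by auto
  then show "(\<lambda>p. k + p * ln (p / ln p - A) - B * (p / ln p + 1)
      - (p / ln p + 1) * ln (p / ln p + 1 + (\<gamma> + 1)) - p * log_rate p) \<in> O(\<lambda>p. p / ln p)"
    unfolding log_rate_def using assms by real_asymp
  have "\<forall>\<^sub>F p in at_top. 0 < p / ln p - A" using assms by real_asymp
  then show "\<forall>\<^sub>F p in at_top. exp (k + p * ln (p / ln p - A) - B * (p / ln p + 1)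
      - (p / ln p + 1) * ln (p / ln p + 1 + (\<gamma> + 1)))
    \<le> K * ((real (peak p) - A) powr p * lam ^ peak p / Gamma (real (peak p) + \<gamma> + 1))"
    using eventually_gt_at_top[of 1]
  proof eventually_elim
    case (elim p)
    define x where "x = p / ln p"
    define n where "n = peak p"
    have n: "x \<le> real n" "real n \<le> x + 1" using peak_bounds[OF elim(2)] by (auto simp: x_def n_def)
    have x: "x > A" using elim by (simp add: x_def)
    have n1: "1 \<le> real n" using x n assms by (cases n) auto
    have G: "Gamma (real n + \<gamma> + 1) > 0" using assms by (intro Gamma_real_pos) auto
    have 1: "p * ln (x - A) \<le> p * ln (real n - A)" using x n elim by (intro mult_left_mono) auto
    have "\<bar>real n * ln lam\<bar> \<le> (x + 1) * B" unfolding abs_mult B_def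
      using n x assms by (intro mult_mono) auto
    then have 2: "- (B * (x + 1)) \<le> real n * ln lam" by (simp add: abs_le_iff mult.commute)
    have "ln (Gamma (real n + \<gamma> + 1)) \<le> ln (Gamma (\<gamma> + 1) * (real n + \<gamma>) ^ n)"
      using G Gamma_add_Suc_of_nat(2)[of \<gamma> n] assms by (intro ln_mono) auto
    also have "\<dots> = ln (Gamma (\<gamma> + 1)) + real n * ln (real n + \<gamma>)"
      using G0 less_imp_neq[OF G0] n x assms by (simp add: ln_mult ln_realpow)
    \<comment> \<open>Monotonicity of the product requires a nonnegative logarithm, hence
      \<open>n1\<close>. The shift \<gamma> + 1 in place of \<gamma> weakens the bound harmlessly
      and is strictly positive.\<close>
    also have "real n * ln (real n + \<gamma>) \<le> (x + 1) * ln (x + 1 + (\<gamma> + 1))"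
      using n n1 x assms by (intro mult_mono ln_mono ln_ge_zero) linarith+
    finally have 3: "ln (Gamma (real n + \<gamma> + 1))
      \<le> ln (Gamma (\<gamma> + 1)) + (x + 1) * ln (x + 1 + (\<gamma> + 1))" by simp
    have "exp (k + p * ln (x - A) - B * (x + 1) - (x + 1) * ln (x + 1 + (\<gamma> + 1)))
      \<le> exp (ln K + p * ln (real n - A) + real n * ln lam - ln (Gamma (real n + \<gamma> + 1)))"
      unfolding k_def using 1 2 3 by simp
    also have "\<dots> = K * ((real n - A) powr p * lam ^ n / Gamma (real n + \<gamma> + 1))"
      using assms x n G by (simp add: exp_add exp_diff powr_def exp_of_nat_mult)
    finally show ?case by (simp add: x_def n_def)
  qed
qed

section \<open>The functions B4 and D4\<close>

text \<open>This is |n - a| <= n + |a| together with the lower bound for Gamma. The extra 1 makes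
  the shift positive, as \<open>rate_le_poisson_moment\<close> demands.\<close>

lemma B4_term_le:
  fixes a lam \<gamma> p :: real
  assumes "lam > 0" "\<gamma> \<ge> 0" "p > 0"
  shows "\<bar>real n - a\<bar> powr p * lam ^ n / (exp lam * Gamma (real n + \<gamma> + 1))
    \<le> 1 / (exp lam * Gamma (\<gamma> + 1)) * ((real n + (\<bar>a\<bar> + 1)) powr p * lam ^ n / fact n)"
proof -
  have "\<bar>real n - a\<bar> powr p \<le> (real n + (\<bar>a\<bar> + 1)) powr p"
    using assms by (intro powr_mono2) auto
  moreover have "Gamma (\<gamma> + 1) > 0" using assms by (intro Gamma_real_pos) auto
  ultimately have "\<bar>real n - a\<bar> powr p * lam ^ n / (exp lam * Gamma (real n + \<gamma> + 1))
    \<le> (real n + (\<bar>a\<bar> + 1)) powr p * lam ^ n / (exp lam * (Gamma (\<gamma> + 1) * fact n))"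
    using assms Gamma_add_Suc_of_nat(1)[of \<gamma> n]
    by (intro frac_le mult_mono mult_left_mono mult_pos_pos) auto
  then show ?thesis by (simp add: field_simps)
qed

lemma B4_term_nonneg:
  fixes a lam \<gamma> p :: real
  assumes "lam > 0" "\<gamma> \<ge> 0"
  shows "0 \<le> \<bar>real n - a\<bar> powr p * lam ^ n / (exp lam * Gamma (real n + \<gamma> + 1))"
proof -
  have "Gamma (real n + \<gamma> + 1) > 0" using assms by (intro Gamma_real_pos) auto
  then show ?thesis using assms by auto
qed

lemma summable_B4:
  fixes a lam \<gamma> p :: real
  assumes "lam > 0" "\<gamma> \<ge> 0" "p > 0"
  shows "summable (\<lambda>n. \<bar>real n - a\<bar> powr p * lam ^ n / (exp lam * Gamma (real n + \<gamma> + 1)))"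
proof (rule summable_comparison_test')
  show "summable (\<lambda>n. 1 / (exp lam * Gamma (\<gamma> + 1)) *
      ((real n + (\<bar>a\<bar> + 1)) powr p * lam ^ n / fact n))"
    using assms by (intro summable_mult poisson_moment_bound(1)[where t = 1]) auto
qed (use B4_term_le[OF assms] B4_term_nonneg[OF assms(1,2)] in \<open>simp only: real_norm_def abs_of_nonneg\<close>)

lemma rate_le_B4:
  fixes a lam \<gamma> :: real
  assumes "lam > 0" "\<gamma> \<ge> 0"
  shows "rate_le at_top (\<lambda>p. p) (\<lambda>p. B4 p a lam \<gamma>)"
proof (rule rate_le_mono)
  have G0: "Gamma (\<gamma> + 1) > 0" using assms by (intro Gamma_real_pos) auto
  then show "rate_le at_top (\<lambda>p. p)
      (\<lambda>p. 1 / (exp lam * Gamma (\<gamma> + 1)) * poisson_moment p (\<bar>a\<bar> + 1) lam)"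
    using assms by (intro rate_le_poisson_moment) auto
  show "\<forall>\<^sub>F p in at_top. B4 p a lam \<gamma>
      \<le> 1 / (exp lam * Gamma (\<gamma> + 1)) * poisson_moment p (\<bar>a\<bar> + 1) lam"
    using eventually_gt_at_top[of 0]
  proof eventually_elim
    case (elim p)
    have s: "summable (\<lambda>n. (real n + (\<bar>a\<bar> + 1)) powr p * lam ^ n / fact n)"
      using assms elim by (intro poisson_moment_bound(1)[where t = 1]) auto
    show ?case unfolding B4_def poisson_moment_def suminf_mult[OF s, symmetric]
      using assms elim s by (intro suminf_le B4_term_le summable_B4 summable_mult) auto
  qed
qed

lemma rate_ge_B4:
  fixes a lam \<gamma> :: real
  assumes "lam > 0" "\<gamma> \<ge> 0"
  shows "rate_ge at_top (\<lambda>p. p) (\<lambda>p. B4 p a lam \<gamma>)"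
proof (rule rate_ge_mono)
  show "rate_ge at_top (\<lambda>p. p) (\<lambda>p. 1 / exp lam *
      ((real (peak p) - (\<bar>a\<bar> + 1)) powr p * lam ^ peak p / Gamma (real (peak p) + \<gamma> + 1)))"
    using assms by (intro rate_ge_peak_term) auto
  have "\<forall>\<^sub>F p in at_top. \<bar>a\<bar> + 1 \<le> real (peak p)"
    using peak_at_top by (simp add: filterlim_at_top)
  then show "\<forall>\<^sub>F p in at_top. 1 / exp lam *
      ((real (peak p) - (\<bar>a\<bar> + 1)) powr p * lam ^ peak p / Gamma (real (peak p) + \<gamma> + 1))
      \<le> B4 p a lam \<gamma>"
    using eventually_gt_at_top[of 0]
  proof eventually_elim
    case (elim p)
    define n where "n = peak p"
    have G: "Gamma (real n + \<gamma> + 1) > 0" using assms by (intro Gamma_real_pos) auto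
    have "1 / exp lam * ((real n - (\<bar>a\<bar> + 1)) powr p * lam ^ n / Gamma (real n + \<gamma> + 1))
        = (real n - (\<bar>a\<bar> + 1)) powr p * lam ^ n / (exp lam * Gamma (real n + \<gamma> + 1))"
      by simp
    \<comment> \<open>The peak has passed |a| + 1, so the smaller base is nonnegative and
      \<open>powr\<close> is monotone there; it lies below n - a for either sign of
      \<open>a\<close>.\<close>
    also have "\<dots> \<le> \<bar>real n - a\<bar> powr p * lam ^ n / (exp lam * Gamma (real n + \<gamma> + 1))"
      using elim assms G by (intro divide_right_mono mult_right_mono powr_mono2) (auto simp: n_def)
    also have "\<dots> = (\<Sum>n\<in>{n}. \<bar>real n - a\<bar> powr p * lam ^ n / (exp lam * Gamma (real n + \<gamma> + 1)))"
      by simp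
    also have "\<dots> \<le> B4 p a lam \<gamma>" unfolding B4_def
      using assms elim by (intro sum_le_suminf summable_B4 B4_term_nonneg) auto
    finally show ?case by (simp add: n_def)
  qed
qed

section \<open>The signed sums D4\<close>

lemma summable_D4:
  fixes a lam \<gamma> :: real
  assumes "lam > 0" "\<gamma> \<ge> 0"
  shows "summable (\<lambda>n. (real n - a) ^ p * lam ^ n / (exp lam * Gamma (real n + \<gamma> + 1)))"
proof (cases "p = 0")
  \<comment> \<open>The exponent 0 is treated directly, because 0 ^ 0 = 1 but 0 powr 0 = 0. The
    value \<open>D4 0\<close> is the total weight in the next estimates.\<close>
  case True
  have G0: "Gamma (\<gamma> + 1) > 0" using assms by (intro Gamma_real_pos) auto
  have "summable (\<lambda>n. 1 / (exp lam * Gamma (\<gamma> + 1)) * (lam ^ n /\<^sub>R fact n))"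
    by (intro summable_mult sums_summable[OF exp_converges])
  then have "summable (\<lambda>n. lam ^ n / (exp lam * Gamma (real n + \<gamma> + 1)))"
  proof (rule summable_comparison_test')
    fix n
    have "Gamma (real n + \<gamma> + 1) > 0" using assms by (intro Gamma_real_pos) auto
    then have "norm (lam ^ n / (exp lam * Gamma (real n + \<gamma> + 1)))
        = lam ^ n / (exp lam * Gamma (real n + \<gamma> + 1))" using assms by simp
    also have "\<dots> \<le> lam ^ n / (exp lam * (Gamma (\<gamma> + 1) * fact n))"
      using assms Gamma_add_Suc_of_nat(1)[of \<gamma> n] G0
      by (intro frac_le mult_left_mono mult_pos_pos) auto
    finally show "norm (lam ^ n / (exp lam * Gamma (real n + \<gamma> + 1)))
        \<le> 1 / (exp lam * Gamma (\<gamma> + 1)) * (lam ^ n /\<^sub>R fact n)" by (simp add: field_simps)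
  qed
  then show ?thesis using True by simp
next
  case False
  have "norm ((real n - a) ^ p * lam ^ n / (exp lam * Gamma (real n + \<gamma> + 1)))
      = \<bar>real n - a\<bar> powr p * lam ^ n / (exp lam * Gamma (real n + \<gamma> + 1))" for n
  proof -
    have "Gamma (real n + \<gamma> + 1) > 0" using assms by (intro Gamma_real_pos) auto
    then show ?thesis using False assms by (simp add: abs_mult power_abs powr_realpow')
  qed
  note norm_eq = this
  show ?thesis
    by (rule summable_norm_cancel, unfold norm_eq, rule summable_B4) (use assms False in auto)
qed

lemma D4_le_B4:
  fixes a lam \<gamma> :: real
  assumes "lam > 0" "\<gamma> \<ge> 0" "p > 0"
  shows "D4 p a lam \<gamma> \<le> B4 (real p) a lam \<gamma>"
  unfolding D4_def B4_def
proof (intro suminf_le summable_D4 summable_B4)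
  fix n
  have "Gamma (real n + \<gamma> + 1) > 0" using assms by (intro Gamma_real_pos) auto
  moreover have "(real n - a) ^ p \<le> \<bar>real n - a\<bar> powr real p"
    using assms by (metis abs_ge_self abs_ge_zero neq0_conv power_abs powr_realpow')
  ultimately show "(real n - a) ^ p * lam ^ n / (exp lam * Gamma (real n + \<gamma> + 1))
      \<le> \<bar>real n - a\<bar> powr real p * lam ^ n / (exp lam * Gamma (real n + \<gamma> + 1))"
    using assms by (intro divide_right_mono mult_right_mono) auto
qed (use assms in auto)

text \<open>Adding |a|^p times the weight to each term makes all terms nonnegative: if n < a, then
  |n - a| <= |a| because n >= 0. A single term is then at most the whole sum, and the total added is
  |a|^p * \<open>D4 0\<close>. The series need not be split at \<open>a\<close>.\<close>

lemma D4_ge_term: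
  fixes a lam \<gamma> :: real
  assumes "lam > 0" "\<gamma> \<ge> 0"
  shows "(real m - a) ^ p * lam ^ m / (exp lam * Gamma (real m + \<gamma> + 1))
    - \<bar>a\<bar> ^ p * D4 0 a lam \<gamma> \<le> D4 p a lam \<gamma>"
proof -
  define c where "c n = lam ^ n / (exp lam * Gamma (real n + \<gamma> + 1))" for n
  have c: "c n \<ge> 0" for n
  proof -
    have "Gamma (real n + \<gamma> + 1) > 0" using assms by (intro Gamma_real_pos) auto
    then show ?thesis using assms by (simp add: c_def)
  qed
  have s: "summable (\<lambda>n. (real n - a) ^ k * c n)" for k
    using summable_D4[OF assms, of a k] by (simp add: c_def)
  have D: "D4 k a lam \<gamma> = (\<Sum>n. (real n - a) ^ k * c n)" for k
    by (simp add: D4_def c_def)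
  have nn: "0 \<le> (real n - a) ^ p * c n + \<bar>a\<bar> ^ p * c n" for n
  proof -
    have "- (\<bar>a\<bar> ^ p) \<le> (real n - a) ^ p"
    proof (cases "real n \<ge> a")
      case True
      then have "0 \<le> (real n - a) ^ p" by simp
      moreover have "0 \<le> \<bar>a\<bar> ^ p" by simp
      ultimately show ?thesis by linarith
    next
      case False
      then have "\<bar>real n - a\<bar> ^ p \<le> \<bar>a\<bar> ^ p" by (intro power_mono) auto
      then show ?thesis by (simp add: power_abs[symmetric] abs_le_iff)
    qed
    then have "0 \<le> ((real n - a) ^ p + \<bar>a\<bar> ^ p) * c n" using c by (intro mult_nonneg_nonneg) auto
    then show ?thesis by (simp add: algebra_simps)
  qed
  have s0: "summable c" using s[of 0] by simp
  have "(real m - a) ^ p * c m \<le> (\<Sum>n\<in>{m}. (real n - a) ^ p * c n + \<bar>a\<bar> ^ p * c n)"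
    using c by simp
  also have "\<dots> \<le> (\<Sum>n. (real n - a) ^ p * c n + \<bar>a\<bar> ^ p * c n)"
    using nn s s0 by (intro sum_le_suminf summable_add summable_mult) auto
  also have "\<dots> = D4 p a lam \<gamma> + \<bar>a\<bar> ^ p * D4 0 a lam \<gamma>"
    using s s0 by (simp add: D suminf_add[symmetric] suminf_mult summable_mult)
  finally show ?thesis by (simp add: c_def)
qed

text \<open>The exponent on the right grows like p ln p, the one on the left only linearly.\<close>

lemma rate_ge_dominates_powr:
  fixes A K :: real
  assumes "rate_ge at_top (\<lambda>p. p) f" "A > 0" "K > 0"
  shows "\<forall>\<^sub>F p in at_top. K * A powr p \<le> f p"
proof -
  obtain C where C: "\<forall>\<^sub>F p in at_top. exp (p * (log_rate p - C / ln p)) \<le> f p"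
    using assms(1) unfolding rate_ge_def by blast
  have "\<forall>\<^sub>F p in at_top. ln K + p * ln A
      \<le> p * (ln p - 1 - ln (ln p) + ln (ln p) / ln p - C / ln p)" by real_asymp
  with C show ?thesis
  proof eventually_elim
    case (elim p)
    have "K * A powr p = exp (ln K + p * ln A)" using assms by (simp add: exp_add powr_def)
    also have "\<dots> \<le> exp (p * (log_rate p - C / ln p))" using elim by (simp add: log_rate_def)
    finally show ?case using elim by linarith
  qed
qed

lemma rate_ge_D4:
  fixes a lam \<gamma> :: real
  assumes "lam > 0" "\<gamma> \<ge> 0"
  shows "rate_ge sequentially real (\<lambda>p. D4 p a lam \<gamma>)"
proof (rule rate_ge_mono)
  \<comment> \<open>Half of the peak term: the other half pays for the correction in
    \<open>D4_ge_term\<close>. Below, |a| and |\<open>D4 0\<close>| are increased by 1 so that the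
    correction is bounded by K * A powr p with positive K and A.\<close>
  define h where "h p = 1 / (2 * exp lam) *
      ((real (peak p) - (\<bar>a\<bar> + 1)) powr p * lam ^ peak p / Gamma (real (peak p) + \<gamma> + 1))" for p
  have h: "rate_ge at_top (\<lambda>p. p) h" unfolding h_def
    using assms by (intro rate_ge_peak_term) auto
  then show "rate_ge sequentially real (\<lambda>p. h (real p))"
    by (rule rate_ge_compose) (rule filterlim_real_sequentially)
  have "\<forall>\<^sub>F p in at_top. \<bar>a\<bar> + 1 \<le> real (peak p)"
    using peak_at_top by (simp add: filterlim_at_top)
  then have peak: "\<forall>\<^sub>F p in sequentially. \<bar>a\<bar> + 1 \<le> real (peak (real p))"
    by (rule eventually_compose_filterlim) (rule filterlim_real_sequentially)
  have "\<forall>\<^sub>F p in at_top. (\<bar>D4 0 a lam \<gamma>\<bar> + 1) * (\<bar>a\<bar> + 1) powr p \<le> h p"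
    by (rule rate_ge_dominates_powr[OF h]) auto
  then have "\<forall>\<^sub>F p in sequentially. (\<bar>D4 0 a lam \<gamma>\<bar> + 1) * (\<bar>a\<bar> + 1) powr real p \<le> h (real p)"
    by (rule eventually_compose_filterlim) (rule filterlim_real_sequentially)
  with peak show "\<forall>\<^sub>F p in sequentially. h (real p) \<le> D4 p a lam \<gamma>"
    using eventually_gt_at_top[of 0]
  proof eventually_elim
    case (elim p)
    define n where "n = peak (real p)"
    have G: "Gamma (real n + \<gamma> + 1) > 0" using assms by (intro Gamma_real_pos) auto
    have n: "\<bar>a\<bar> + 1 \<le> real n" using elim by (simp add: n_def)
    have "(real n - (\<bar>a\<bar> + 1)) powr real p = (real n - (\<bar>a\<bar> + 1)) ^ p"
      using n elim by (intro powr_realpow') auto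
    also have "\<dots> \<le> (real n - a) ^ p" using n by (intro power_mono) auto
    finally have "(real n - (\<bar>a\<bar> + 1)) powr real p * lam ^ n / (exp lam * Gamma (real n + \<gamma> + 1))
        \<le> (real n - a) ^ p * lam ^ n / (exp lam * Gamma (real n + \<gamma> + 1))"
      using assms G by (intro divide_right_mono mult_right_mono) auto
    moreover have "2 * h (real p)
        = (real n - (\<bar>a\<bar> + 1)) powr real p * lam ^ n / (exp lam * Gamma (real n + \<gamma> + 1))"
      by (simp add: h_def n_def)
    moreover have "\<bar>a\<bar> ^ p * D4 0 a lam \<gamma> \<le> \<bar>a\<bar> ^ p * (\<bar>D4 0 a lam \<gamma>\<bar> + 1)"
      by (intro mult_left_mono) auto
    moreover have "\<dots> \<le> (\<bar>a\<bar> + 1) ^ p * (\<bar>D4 0 a lam \<gamma>\<bar> + 1)"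
      by (intro mult_right_mono power_mono) auto
    moreover have "\<dots> \<le> h (real p)"
      using elim(2) powr_realpow[of "\<bar>a\<bar> + 1" p] by (simp add: mult.commute)
    moreover note D4_ge_term[OF assms, of n a p]
    ultimately show ?case by linarith
  qed
qed

section \<open>The functions F3 and G3\<close>

text \<open>The term m = 0 gives the lower bound. For the upper one, (n + m)! >= n! leaves an
  exponential series at \<beta>^2 / 4. The loss is a factor independent of k, so sums of Bessel
  functions reduce to Poisson sums.\<close>

lemma bessel_I_int_bounds:
  fixes \<beta> :: real
  assumes "\<beta> > 0"
  shows "(\<beta> / 2) ^ nat \<bar>k\<bar> / fact (nat \<bar>k\<bar>) \<le> bessel_I_int k \<beta>"
    and "bessel_I_int k \<beta> \<le> exp (\<beta>\<^sup>2 / 4) * ((\<beta> / 2) ^ nat \<bar>k\<bar> / fact (nat \<bar>k\<bar>))"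
proof -
  define n where "n = nat \<bar>k\<bar>"
  define s where "s m = \<beta> ^ (2 * m) / (4 ^ m * (fact m * fact (n + m)))" for m :: nat
  have nk: "\<bar>real_of_int k\<bar> = real n" by (simp add: n_def)
  have "Gamma (real n + real m + 1) = fact (n + m)" for m
    using Gamma_fact[of "n + m", where ?'a = real] by (simp add: add_ac)
  then have I: "bessel_I_int k \<beta> = (\<beta> / 2) ^ n * (\<Sum>m. s m)"
    using assms unfolding bessel_I_int_def bessel_I_def nk s_def
    by (simp add: powr_minus powr_realpow field_simps)
  have s0: "s m \<ge> 0" for m using assms by (simp add: s_def)
  have sums: "(\<lambda>m. 1 / fact n * ((\<beta>\<^sup>2 / 4) ^ m /\<^sub>R fact m)) sums (1 / fact n * exp (\<beta>\<^sup>2 / 4))"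
    by (intro sums_mult exp_converges)
  have le: "s m \<le> 1 / fact n * ((\<beta>\<^sup>2 / 4) ^ m /\<^sub>R fact m)" for m
  proof -
    have "s m \<le> \<beta> ^ (2 * m) / (4 ^ m * (fact m * fact n))"
      unfolding s_def using assms by (intro divide_left_mono mult_left_mono fact_mono) auto
    also have "\<beta> ^ (2 * m) = (\<beta>\<^sup>2) ^ m" by (rule power_mult)
    also have "\<dots> / (4 ^ m * (fact m * fact n)) = 1 / fact n * ((\<beta>\<^sup>2 / 4) ^ m /\<^sub>R fact m)"
      unfolding power_divide real_scaleR_def inverse_eq_divide times_divide_times_eq
        times_divide_eq_left times_divide_eq_right divide_divide_eq_left by (simp only: mult_1 mult_1_right mult_ac)
    finally show ?thesis .
  qed
  have summ: "summable s"
    by (rule summable_comparison_test'[OF sums_summable[OF sums], of 0]) (use s0 le in auto)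
  have "(\<Sum>m\<in>{0}. s m) \<le> (\<Sum>m. s m)" using s0 summ by (intro sum_le_suminf) auto
  then have "1 / fact n \<le> (\<Sum>m. s m)" by (simp add: s_def)
  then have "(\<beta> / 2) ^ n * (1 / fact n) \<le> bessel_I_int k \<beta>"
    unfolding I using assms by (intro mult_left_mono) auto
  then show "(\<beta> / 2) ^ nat \<bar>k\<bar> / fact (nat \<bar>k\<bar>) \<le> bessel_I_int k \<beta>" by (simp add: n_def)
  have "(\<Sum>m. s m) \<le> 1 / fact n * exp (\<beta>\<^sup>2 / 4)"
    using suminf_le[OF le summ sums_summable[OF sums]] sums_unique[OF sums] by simp
  then have "bessel_I_int k \<beta> \<le> (\<beta> / 2) ^ n * (1 / fact n * exp (\<beta>\<^sup>2 / 4))"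
    unfolding I using assms by (intro mult_left_mono) auto
  then show "bessel_I_int k \<beta> \<le> exp (\<beta>\<^sup>2 / 4) * ((\<beta> / 2) ^ nat \<bar>k\<bar> / fact (nat \<bar>k\<bar>))"
    by (simp add: n_def mult_ac)
qed

lemma bessel_I_int_nonneg:
  assumes "\<beta> > 0"
  shows "0 \<le> bessel_I_int k \<beta>"
  by (rule order_trans[OF _ bessel_I_int_bounds(1)]) (use assms in auto)

text \<open>Each index n is the absolute value of at most two integers.\<close>

lemma infsum_int_le_suminf:
  fixes f :: "int \<Rightarrow> real" and u :: "nat \<Rightarrow> real"
  assumes "\<And>k. 0 \<le> f k" "\<And>k. f k \<le> u (nat \<bar>k\<bar>)" "summable u"
  shows "f summable_on UNIV" and "infsum f UNIV \<le> 2 * suminf u"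
proof -
  have u: "0 \<le> u n" for n using assms(1,2)[of "int n"] by simp
  have fin: "sum f A \<le> 2 * suminf u" if "finite A" for A
  proof -
    have part: "sum f B \<le> suminf u" if "finite B" "inj_on (\<lambda>k. nat \<bar>k\<bar>) B" for B
    proof -
      have "sum f B \<le> (\<Sum>k\<in>B. u (nat \<bar>k\<bar>))" by (intro sum_mono assms)
      also have "\<dots> = sum u ((\<lambda>k. nat \<bar>k\<bar>) ` B)" using that by (simp add: sum.reindex)
      also have "\<dots> \<le> suminf u" using that u assms(3) by (intro sum_le_suminf) auto
      finally show ?thesis .
    qed
    \<comment> \<open>On each of the two halves the map k -> |k| is injective, so each is bounded by
      the sum over the naturals.\<close>
    have "sum f A = sum f (A \<inter> {0..}) + sum f (A \<inter> {..<0})"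
      using that by (subst sum.union_disjoint[symmetric]) (auto intro!: sum.cong)
    moreover have "sum f (A \<inter> {0..}) \<le> suminf u" "sum f (A \<inter> {..<0}) \<le> suminf u"
      using that by (auto intro!: part inj_onI)
    ultimately show ?thesis by simp
  qed
  show s: "f summable_on UNIV"
    by (rule nonneg_bdd_above_summable_on) (use assms fin in \<open>auto intro!: bdd_aboveI\<close>)
  show "infsum f UNIV \<le> 2 * suminf u" by (rule infsum_le_finite_sums[OF s]) (use fin in auto)
qed

lemma powi_le_max_inverse:
  fixes \<theta> :: real
  assumes "\<theta> > 0"
  shows "\<theta> powi k \<le> max \<theta> (1 / \<theta>) ^ nat \<bar>k\<bar>"
proof (cases "k \<ge> 0")
  case True
  then show ?thesis using assms by (auto simp: power_int_def intro!: power_mono)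
next
  case False
  then show ?thesis using assms by (auto simp: power_int_def inverse_eq_divide intro!: power_mono)
qed

section \<open>Growth of F3\<close>

lemma F3_bounds:
  fixes \<theta> \<beta> p :: real
  assumes "\<theta> > 0" "\<beta> > 0" "p > 0"
  shows summable_F3: "(\<lambda>k. \<bar>real_of_int k\<bar> powr p * \<theta> powi k * bessel_I_int k \<beta>) summable_on UNIV"
    and F3_le: "F3 p \<theta> \<beta> \<le> 2 * exp (\<beta>\<^sup>2 / 4) * poisson_moment p 1 (max \<theta> (1 / \<theta>) * (\<beta> / 2))"
proof -
  define M where "M = max \<theta> (1 / \<theta>)"
  define f where "f k = \<bar>real_of_int k\<bar> powr p * \<theta> powi k * bessel_I_int k \<beta>" for k
  define w where "w n = (real n + 1) powr p * (M * (\<beta> / 2)) ^ n / fact n" for n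
  have M: "M > 0" using assms by (simp add: M_def less_max_iff_disj)
  have I0: "bessel_I_int k \<beta> \<ge> 0" for k
    using assms by (intro bessel_I_int_nonneg)
  have 1: "0 \<le> f k" for k using assms I0 by (simp add: f_def)
  have 2: "f k \<le> exp (\<beta>\<^sup>2 / 4) * w (nat \<bar>k\<bar>)" for k
  proof -
    define n where "n = nat \<bar>k\<bar>"
    have nk: "\<bar>real_of_int k\<bar> = real n" by (simp add: n_def)
    have "f k \<le> (real n + 1) powr p * M ^ n * (exp (\<beta>\<^sup>2 / 4) * ((\<beta> / 2) ^ n / fact n))"
      unfolding f_def nk
    proof (intro mult_mono)
      show "\<theta> powi k \<le> M ^ n" using powi_le_max_inverse[OF assms(1)] by (simp add: M_def n_def)
      show "bessel_I_int k \<beta> \<le> exp (\<beta>\<^sup>2 / 4) * ((\<beta> / 2) ^ n / fact n)"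
        using bessel_I_int_bounds(2)[OF assms(2)] by (simp add: n_def)
    qed (use assms M I0 in \<open>auto intro!: powr_mono2\<close>)
    also have "\<dots> = exp (\<beta>\<^sup>2 / 4) * w n" unfolding w_def power_mult_distrib by simp
    finally show ?thesis by (simp add: n_def)
  qed
  have w: "summable w" unfolding w_def
    using assms M by (intro poisson_moment_bound(1)[where t = 1]) auto
  then have s: "summable (\<lambda>n. exp (\<beta>\<^sup>2 / 4) * w n)" by (rule summable_mult)
  show "(\<lambda>k. \<bar>real_of_int k\<bar> powr p * \<theta> powi k * bessel_I_int k \<beta>) summable_on UNIV"
    using infsum_int_le_suminf(1)[OF 1 2 s] by (simp add: f_def)
  have "infsum f UNIV \<le> 2 * (exp (\<beta>\<^sup>2 / 4) * suminf w)"
    using infsum_int_le_suminf(2)[OF 1 2 s] unfolding suminf_mult[OF w] .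
  then show "F3 p \<theta> \<beta> \<le> 2 * exp (\<beta>\<^sup>2 / 4) * poisson_moment p 1 (max \<theta> (1 / \<theta>) * (\<beta> / 2))"
    unfolding F3_def f_def poisson_moment_def w_def M_def by (simp only: mult.assoc)
qed

lemma rate_le_F3:
  fixes \<theta> \<beta> :: real
  assumes "\<theta> > 0" "\<beta> > 0"
  shows "rate_le at_top (\<lambda>p. p) (\<lambda>p. F3 p \<theta> \<beta>)"
proof (rule rate_le_mono)
  show "rate_le at_top (\<lambda>p. p)
      (\<lambda>p. 2 * exp (\<beta>\<^sup>2 / 4) * poisson_moment p 1 (max \<theta> (1 / \<theta>) * (\<beta> / 2)))"
    using assms by (intro rate_le_poisson_moment) (auto simp: less_max_iff_disj)
  show "\<forall>\<^sub>F p in at_top. F3 p \<theta> \<beta> \<le> 2 * exp (\<beta>\<^sup>2 / 4) * poisson_moment p 1 (max \<theta> (1 / \<theta>) * (\<beta> / 2))"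
    using eventually_gt_at_top[of 0] by eventually_elim (intro F3_le assms)
qed

lemma F3_ge_term:
  fixes \<theta> \<beta> p :: real
  assumes "\<theta> > 0" "\<beta> > 0" "p > 0"
  shows "real n powr p * (\<theta> * (\<beta> / 2)) ^ n / fact n \<le> F3 p \<theta> \<beta>"
proof -
  define f where "f k = \<bar>real_of_int k\<bar> powr p * \<theta> powi k * bessel_I_int k \<beta>" for k
  have "bessel_I_int k \<beta> \<ge> 0" for k
    using assms by (intro bessel_I_int_nonneg)
  then have f0: "f k \<ge> 0" for k using assms by (simp add: f_def)
  have "real n powr p * (\<theta> * (\<beta> / 2)) ^ n / fact n = real n powr p * \<theta> ^ n * ((\<beta> / 2) ^ n / fact n)"
    unfolding power_mult_distrib by simp
  also have "\<dots> \<le> f (int n)" unfolding f_def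
    using mult_left_mono[OF bessel_I_int_bounds(1)[OF assms(2), of "int n"], of "real n powr p * \<theta> ^ n"] assms
    by simp
  also have "\<dots> = sum f {int n}" by simp
  also have "\<dots> \<le> infsum f UNIV"
    using summable_F3[OF assms] f0 by (intro finite_sum_le_infsum) (auto simp: f_def[abs_def])
  finally show ?thesis by (simp add: F3_def f_def[abs_def])
qed

text \<open>The case \<gamma> = 0, with n - 1 as a lower bound for n because
  \<open>rate_ge_peak_term\<close> takes a positive shift.\<close>

lemma rate_ge_peak_fact:
  fixes K lam :: real
  assumes "K > 0" "lam > 0"
  shows "rate_ge at_top (\<lambda>p. p) (\<lambda>p. K * (real (peak p) powr p * lam ^ peak p / fact (peak p)))"
proof (rule rate_ge_mono)
  show "rate_ge at_top (\<lambda>p. p)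
      (\<lambda>p. K * ((real (peak p) - 1) powr p * lam ^ peak p / Gamma (real (peak p) + 0 + 1)))"
    using assms by (intro rate_ge_peak_term) auto
  have "\<forall>\<^sub>F p in at_top. 1 \<le> real (peak p)"
    using peak_at_top by (simp only: filterlim_at_top)
  then show "\<forall>\<^sub>F p in at_top. K * ((real (peak p) - 1) powr p * lam ^ peak p / Gamma (real (peak p) + 0 + 1))
      \<le> K * (real (peak p) powr p * lam ^ peak p / fact (peak p))"
    using eventually_gt_at_top[of 0]
  proof eventually_elim
    case (elim p)
    have "Gamma (real (peak p) + 0 + 1) = fact (peak p)"
      using Gamma_fact[of "peak p", where ?'a = real] by (simp add: add_ac)
    then show ?case using assms elim
      by (auto intro!: mult_left_mono divide_right_mono mult_right_mono powr_mono2)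
  qed
qed

text \<open>Keeping an index k = n >= 0 is good enough even for \<theta> < 1, where k = -n gives the
  larger term: the ratio is a power of \<theta> with exponent O(p / ln p).\<close>

lemma rate_ge_F3:
  fixes \<theta> \<beta> :: real
  assumes "\<theta> > 0" "\<beta> > 0"
  shows "rate_ge at_top (\<lambda>p. p) (\<lambda>p. F3 p \<theta> \<beta>)"
proof (rule rate_ge_mono)
  show "rate_ge at_top (\<lambda>p. p)
      (\<lambda>p. 1 * (real (peak p) powr p * (\<theta> * (\<beta> / 2)) ^ peak p / fact (peak p)))"
    using assms by (intro rate_ge_peak_fact) auto
  show "\<forall>\<^sub>F p in at_top.
      1 * (real (peak p) powr p * (\<theta> * (\<beta> / 2)) ^ peak p / fact (peak p)) \<le> F3 p \<theta> \<beta>"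
    using eventually_gt_at_top[of 0]
    by eventually_elim (unfold mult_1_left, intro F3_ge_term assms)
qed

section \<open>The signed sums G3\<close>

lemma G3_even:
  assumes "even p" "p > 0"
  shows "G3 p \<theta> \<beta> = F3 (real p) \<theta> \<beta>"
proof -
  have "real_of_int k ^ p = \<bar>real_of_int k\<bar> powr real p" for k
    using assms by (simp add: powr_realpow' power_even_abs)
  then show ?thesis unfolding G3_def F3_def by simp
qed

lemma summable_G3:
  fixes \<theta> \<beta> :: real
  assumes "\<theta> > 0" "\<beta> > 0" "p > 0"
  shows "(\<lambda>k. real_of_int k ^ p * \<theta> powi k * bessel_I_int k \<beta>) summable_on UNIV"
proof -
  have "bessel_I_int k \<beta> \<ge> 0" for k
    using assms by (intro bessel_I_int_nonneg)
  then have "norm (real_of_int k ^ p * \<theta> powi k * bessel_I_int k \<beta>)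
      = \<bar>real_of_int k\<bar> powr real p * \<theta> powi k * bessel_I_int k \<beta>" for k
    using assms by (simp add: abs_mult power_abs powr_realpow')
  then show ?thesis using summable_F3[of \<theta> \<beta> "real p"] assms
    by (subst summable_on_iff_abs_summable_on_real) simp
qed

lemma G3_le_F3:
  fixes \<theta> \<beta> :: real
  assumes "\<theta> > 0" "\<beta> > 0" "p > 0"
  shows "G3 p \<theta> \<beta> \<le> F3 (real p) \<theta> \<beta>"
  unfolding G3_def F3_def
proof (intro infsum_mono summable_G3 summable_F3)
  fix k
  have "bessel_I_int k \<beta> \<ge> 0"
    using assms by (intro bessel_I_int_nonneg)
  moreover have "real_of_int k ^ p \<le> \<bar>real_of_int k\<bar> powr real p"
    using assms by (metis abs_ge_self abs_ge_zero neq0_conv power_abs powr_realpow')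
  ultimately show "real_of_int k ^ p * \<theta> powi k * bessel_I_int k \<beta>
      \<le> \<bar>real_of_int k\<bar> powr real p * \<theta> powi k * bessel_I_int k \<beta>"
    using assms by (intro mult_right_mono) auto
qed (use assms in auto)

text \<open>The series is added to its reflection under k -> -k, which has the same sum; this gives
  twice \<open>G3\<close> while still summing over all integers.\<close>

lemma G3_odd:
  fixes \<theta> \<beta> :: real
  assumes "\<theta> > 0" "\<beta> > 0" "odd p"
  defines "s \<equiv> \<lambda>n. real n ^ p * (\<theta> ^ n - (1 / \<theta>) ^ n) * bessel_I_int (int n) \<beta>"
  shows "((\<lambda>k. s (nat \<bar>k\<bar>)) has_sum 2 * G3 p \<theta> \<beta>) UNIV"
proof -
  define f where "f k = real_of_int k ^ p * \<theta> powi k * bessel_I_int k \<beta>" for k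
  have "p > 0" using assms by (simp add: odd_pos)
  then have f: "(f has_sum G3 p \<theta> \<beta>) UNIV"
    using summable_G3[OF assms(1,2)] by (simp add: G3_def f_def[abs_def])
  have "bij (uminus :: int \<Rightarrow> int)" by (rule bij_uminus)
  then have "((\<lambda>k. f (- k)) has_sum G3 p \<theta> \<beta>) UNIV"
    using f by (simp add: has_sum_reindex_bij_betw[where g = uminus and A = UNIV])
  from has_sum_add[OF f this] have *: "((\<lambda>k. f k + f (- k)) has_sum 2 * G3 p \<theta> \<beta>) UNIV" by simp
  have pos: "f (int n) + f (- int n) = s n" for n
    using assms(3) by (simp add: f_def s_def power_minus_odd power_int_minus power_one_over
      inverse_eq_divide bessel_I_int_def algebra_simps)
  have "f k + f (- k) = s (nat \<bar>k\<bar>)" for k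
    using pos[of "nat \<bar>k\<bar>"] by (cases "k \<ge> 0") (auto simp: add.commute)
  with * show ?thesis by simp
qed

lemma G3_odd_nonpos:
  fixes \<theta> \<beta> :: real
  assumes "\<theta> > 0" "\<beta> > 0" "odd p" "\<theta> \<le> 1"
  shows "G3 p \<theta> \<beta> \<le> 0"
proof -
  have "2 * G3 p \<theta> \<beta> \<le> 0"
  proof (rule has_sum_mono[OF G3_odd[OF assms(1-3)]])
    show "((\<lambda>_. 0) has_sum 0) (UNIV :: int set)" by simp
    fix k :: int
    define n where "n = nat \<bar>k\<bar>"
    have "bessel_I_int (int n) \<beta> \<ge> 0"
      using assms by (intro bessel_I_int_nonneg)
    moreover have "\<theta> ^ n \<le> (1 / \<theta>) ^ n"
      using assms by (intro power_mono) (auto simp: field_simps mult_le_one)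
    ultimately show "real n ^ p * (\<theta> ^ n - (1 / \<theta>) ^ n) * bessel_I_int (int n) \<beta> \<le> 0"
      by (intro mult_nonpos_nonneg mult_nonneg_nonpos) auto
  qed
  then show ?thesis by simp
qed

text \<open>For n >= 1 the difference \<theta>^n - (1 / \<theta>)^n is at least its value at n = 1.
  Giving up its growth in n costs only exp (O(p / ln p)) at the peak.\<close>

lemma G3_odd_ge_term:
  fixes \<theta> \<beta> :: real
  assumes "\<theta> > 1" "\<beta> > 0" "odd p"
  shows "(\<theta> - 1 / \<theta>) / 2 * (real n powr real p * (\<beta> / 2) ^ n / fact n) \<le> G3 p \<theta> \<beta>"
proof -
  define s where "s n = real n ^ p * (\<theta> ^ n - (1 / \<theta>) ^ n) * bessel_I_int (int n) \<beta>" for n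
  have p: "p > 0" using assms by (simp add: odd_pos)
  have th1: "1 / \<theta> \<le> 1" using assms by simp
  then have th: "1 / \<theta> \<le> \<theta>" by (rule order_trans) (use assms in simp)
  have I: "bessel_I_int k \<beta> \<ge> 0" for k
    using assms by (intro bessel_I_int_nonneg)
  have "(1 / \<theta>) ^ n \<le> \<theta> ^ n" for n by (rule power_mono[OF th]) (use assms in simp)
  then have s0: "s n \<ge> 0" for n using I by (simp add: s_def)
  have hs: "((\<lambda>k. s (nat \<bar>k\<bar>)) has_sum 2 * G3 p \<theta> \<beta>) UNIV"
    using G3_odd[of \<theta> \<beta> p] assms by (simp add: s_def)
  have "(\<theta> - 1 / \<theta>) * (real n powr real p * (\<beta> / 2) ^ n / fact n) \<le> s n"
  proof (cases "n = 0")
    case True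
    then show ?thesis using p by (simp add: s_def)
  next
    case False
    then have "\<theta> \<le> \<theta> ^ n" "(1 / \<theta>) ^ n \<le> 1 / \<theta>"
      using assms th1 power_increasing[of 1 n \<theta>] power_decreasing[of 1 n "1 / \<theta>"] by auto
    then have d: "\<theta> - 1 / \<theta> \<le> \<theta> ^ n - (1 / \<theta>) ^ n" by linarith
    have d0: "0 \<le> \<theta> ^ n - (1 / \<theta>) ^ n" using d th by linarith
    have "real n ^ p * (\<theta> - 1 / \<theta>) * ((\<beta> / 2) ^ n / fact n) \<le> s n"
      unfolding s_def
      by (rule mult_mono[OF mult_left_mono[OF d]])
        (use assms d0 bessel_I_int_bounds(1)[OF assms(2), of "int n"] in simp_all)
    then show ?thesis using p by (simp add: powr_realpow' mult_ac)
  qed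
  \<comment> \<open>Of the two indices n and -n only one is kept, so the 2 on the right becomes the
    factor 1/2 of the claim.\<close>
  also have "s n = (\<Sum>k\<in>{int n}. s (nat \<bar>k\<bar>))" by simp
  also have "\<dots> \<le> 2 * G3 p \<theta> \<beta>"
    using hs s0 by (intro finite_sum_le_has_sum[OF hs]) auto
  finally show ?thesis unfolding times_divide_eq_left
    by (subst pos_divide_le_eq) (simp_all only: mult.commute zero_less_numeral)
qed

section \<open>Exponents restricted to a set of naturals\<close>

lemma tends_through_le: "tends_through S \<le> sequentially"
  by (simp add: tends_through_def)

lemma eventually_in_tends_through: "\<forall>\<^sub>F p in tends_through S. p \<in> S"
  by (simp add: tends_through_def eventually_inf_principal)

lemma filterlim_real_tends_through: "filterlim real at_top (tends_through S)"
  by (rule filterlim_mono[OF filterlim_real_sequentially order_refl tends_through_le])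

lemma rate_ge_G3:
  fixes \<theta> \<beta> :: real
  assumes "\<theta> > 0" "\<beta> > 0"
  shows "rate_ge (tends_through {p. 0 < p \<and> G3 p \<theta> \<beta> > 0}) real (\<lambda>p. G3 p \<theta> \<beta>)"
proof -
  let ?F = "tends_through {p. 0 < p \<and> G3 p \<theta> \<beta> > 0}"
  note lim = filterlim_real_tends_through[of "{p. 0 < p \<and> G3 p \<theta> \<beta> > 0}"]
  show ?thesis
  proof (cases "\<theta> > 1")
    case True
    then have K: "(\<theta> - 1 / \<theta>) / 2 > 0" by (auto simp: field_simps intro: less_trans[of _ \<theta>])
    \<comment> \<open>One constant for both parities: the bound by 1 serves even p, the other bound
      serves odd p.\<close>
    define K where "K = min ((\<theta> - 1 / \<theta>) / 2) 1"
    have K': "K > 0" "K \<le> (\<theta> - 1 / \<theta>) / 2" "K \<le> 1"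
      unfolding K_def using K by (auto simp: min_def)
    show ?thesis
    proof (rule rate_ge_mono)
      show "rate_ge ?F real (\<lambda>p. K * (real (peak (real p)) powr real p * (\<beta> / 2) ^ peak (real p)
          / fact (peak (real p))))"
        by (rule rate_ge_compose[OF rate_ge_peak_fact lim]) (use K' assms in auto)
      show "\<forall>\<^sub>F p in ?F. K * (real (peak (real p)) powr real p * (\<beta> / 2) ^ peak (real p)
          / fact (peak (real p))) \<le> G3 p \<theta> \<beta>"
        using eventually_in_tends_through
      proof eventually_elim
        case (elim p)
        define n where "n = peak (real p)"
        have "K * (real n powr real p * (\<beta> / 2) ^ n / fact n) \<le> G3 p \<theta> \<beta>"
        proof (cases "even p")
          case True
          have "K * (real n powr real p * (\<beta> / 2) ^ n / fact n)
              \<le> 1 * (real n powr real p * (\<theta> * (\<beta> / 2)) ^ n / fact n)"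
            using K' assms \<open>\<theta> > 1\<close> 
            by (intro mult_mono divide_right_mono mult_left_mono power_mono) auto
          also have "\<dots> \<le> G3 p \<theta> \<beta>"
            using F3_ge_term[OF assms, of "real p" n] G3_even[OF True] elim by simp
          finally show ?thesis .
        next
          case False
          have "K * (real n powr real p * (\<beta> / 2) ^ n / fact n)
              \<le> (\<theta> - 1 / \<theta>) / 2 * (real n powr real p * (\<beta> / 2) ^ n / fact n)"
            using K' assms by (intro mult_right_mono) auto
          also have "\<dots> \<le> G3 p \<theta> \<beta>" using G3_odd_ge_term[OF \<open>\<theta> > 1\<close> assms(2) False] .
          finally show ?thesis .
        qed
        then show ?case by (simp add: n_def)
      qed
    qed
  next
    case False
    \<comment> \<open>Here \<theta> <= 1, so \<open>G3\<close> is not positive at odd exponents; the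
      filter sees even ones only, where \<open>G3\<close> equals \<open>F3\<close>.\<close>
    show ?thesis
    proof (rule rate_ge_mono[OF rate_ge_compose[OF rate_ge_F3[OF assms] lim]])
      show "\<forall>\<^sub>F p in ?F. F3 (real p) \<theta> \<beta> \<le> G3 p \<theta> \<beta>"
        using eventually_in_tends_through
      proof eventually_elim
        case (elim p)
        then have "even p" using G3_odd_nonpos[OF assms, of p] False by force
        then show ?case using G3_even[of p] elim by simp
      qed
    qed
  qed
qed

section \<open>The expansion of B4 and the combined theorem\<close>

lemma log_sim_B4:
  fixes a lam \<gamma> c :: real
  assumes "lam > 0" "\<gamma> \<ge> 0"
  defines "q \<equiv> \<lambda>p. (p - c) / lam"
  shows "log_sim at_top (\<lambda>p. p)
    (\<lambda>p. (1 / lam) * B4 p a lam \<gamma> powr (1 / p) / g (q p)) (\<lambda>p. 1 + Delta (q p))"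
proof (rule log_simI)
  note ge = rate_ge_B4[OF assms(1,2), of a]
  note pos = rate_ge_pos[OF ge]
  have q: "\<forall>\<^sub>F p in at_top. 0 < q p" "\<forall>\<^sub>F p in at_top. 0 < ln (q p)"
    unfolding q_def using assms(1) by real_asymp+
  show D: "\<forall>\<^sub>F p in at_top. 0 < 1 + Delta (q p)"
    unfolding q_def Delta_def using assms(1) by real_asymp
  show "\<forall>\<^sub>F p in at_top. 0 < (1 / lam) * B4 p a lam \<gamma> powr (1 / p) / g (q p)"
    using pos q by eventually_elim (use assms(1) in \<open>simp add: g_def\<close>)
  show "filterlim (\<lambda>p::real. p) at_top at_top" by (rule filterlim_ident)
  \<comment> \<open>Here ln (q p) = ln (p - c) - l with l = \<open>ln lam\<close>, and the factor 1
    / lam cancels this l outside the iterated logarithm. The shift c changes ln p by O(1 / p), and l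
    changes ln (ln p) by O(1 / ln p). The rate contains \<open>Delta\<close> where the claim has ln
    (1 + Delta); the difference is O(Delta^2) = o(1 / ln p).\<close>
  have "(\<lambda>p. ln p - ln (ln p) + ln (ln p) / ln p - ln (p - c) + ln (ln (p - c) - l)
      - ln (1 + ln (ln (p - c) - l) / (ln (p - c) - l))) \<in> O(\<lambda>p. 1 / ln p)" for l
    by real_asymp
  also have "(\<lambda>p. ln p - ln (ln p) + ln (ln p) / ln p - ln (p - c) + ln (ln (p - c) - ln lam)
      - ln (1 + ln (ln (p - c) - ln lam) / (ln (p - c) - ln lam))) \<in> O(\<lambda>p. 1 / ln p)
    \<longleftrightarrow> (\<lambda>p. log_rate p - ln lam - ln (q p) + 1 + ln (ln (q p)) - ln (1 + Delta (q p)))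
      \<in> O(\<lambda>p. 1 / ln p)"
    using eventually_gt_at_top[of c]
    by (intro landau_o.big.in_cong, eventually_elim)
      (use assms(1) in \<open>simp add: log_rate_def Delta_def q_def ln_div\<close>)
  finally have "(\<lambda>p. log_rate p - ln lam - ln (q p) + 1 + ln (ln (q p)) - ln (1 + Delta (q p)))
      \<in> O(\<lambda>p. 1 / ln p)" .
  with rate_bigo[OF rate_le_B4[OF assms(1,2), of a] ge filterlim_ident]
  have "(\<lambda>p. (ln (B4 p a lam \<gamma>) / p - log_rate p)
      + (log_rate p - ln lam - ln (q p) + 1 + ln (ln (q p)) - ln (1 + Delta (q p))))
      \<in> O(\<lambda>p. 1 / ln p)"
    by (rule sum_in_bigo)
  also have "?this \<longleftrightarrow> (\<lambda>p. ln ((1 / lam) * B4 p a lam \<gamma> powr (1 / p) / g (q p))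
      - ln (1 + Delta (q p))) \<in> O(\<lambda>p. 1 / ln p)"
    using pos q
    by (intro landau_o.big.in_cong, eventually_elim)
      (use assms(1) in \<open>simp add: g_def ln_div ln_mult ln_powr\<close>)
  finally show "(\<lambda>p. ln ((1 / lam) * B4 p a lam \<gamma> powr (1 / p) / g (q p))
      - ln (1 + Delta (q p))) \<in> O(\<lambda>p. 1 / ln p)" .
qed

theorem theorem3p1:
  fixes a lam \<gamma> \<theta> \<beta> \<Lambda> :: real and q :: "real \<Rightarrow> real"
  assumes "lam > 0" and "\<gamma> \<ge> 0" and "\<theta> > 0" and "\<beta> > 0"
    and q_def: "\<And>p. q p = (p - a - \<gamma> - 0.5) / lam"
    and Lambda_def: "\<Lambda> = \<beta> * max \<theta> (1 / \<theta>)"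
  shows
    "log_sim at_top (\<lambda>p. p)
       (\<lambda>p. (1 / lam) * B4 p a lam \<gamma> powr (1 / p) / g (q p)) (\<lambda>p. 1 + Delta (q p)) \<and>
     log_asymp at_top (\<lambda>p. p) (\<lambda>p. F3 p \<theta> \<beta>) (\<lambda>p. B4 p 0 \<Lambda> 0) \<and>
     log_asymp (tends_through {p. 0 < p \<and> G3 p \<theta> \<beta> > 0}) real
       (\<lambda>p. F3 (real p) \<theta> \<beta>) (\<lambda>p. G3 p \<theta> \<beta>) \<and>
     log_asymp (tends_through {p. 0 < p \<and> D4 p a lam \<gamma> > 0}) real
       (\<lambda>p. D4 p a lam \<gamma>) (\<lambda>p. B4 (real p) a lam \<gamma>)"
proof (intro conjI)
  have "q = (\<lambda>p. (p - (a + \<gamma> + 0.5)) / lam)" by (simp add: fun_eq_iff q_def algebra_simps)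
  then show "log_sim at_top (\<lambda>p. p)
       (\<lambda>p. (1 / lam) * B4 p a lam \<gamma> powr (1 / p) / g (q p)) (\<lambda>p. 1 + Delta (q p))"
    using log_sim_B4[OF assms(1,2)] by simp
  have "\<Lambda> > 0" using assms by (simp add: Lambda_def less_max_iff_disj)
  then show "log_asymp at_top (\<lambda>p. p) (\<lambda>p. F3 p \<theta> \<beta>) (\<lambda>p. B4 p 0 \<Lambda> 0)"
    using assms by (intro log_asympI rate_le_F3 rate_ge_F3 rate_le_B4 rate_ge_B4 filterlim_ident) auto
  show "log_asymp (tends_through {p. 0 < p \<and> G3 p \<theta> \<beta> > 0}) real
       (\<lambda>p. F3 (real p) \<theta> \<beta>) (\<lambda>p. G3 p \<theta> \<beta>)"
  proof (rule log_asympI[OF _ _ _ rate_ge_G3])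
    let ?S = "{p. 0 < p \<and> G3 p \<theta> \<beta> > 0}"
    note lim = filterlim_real_tends_through[of ?S]
    show le: "rate_le (tends_through ?S) real (\<lambda>p. F3 (real p) \<theta> \<beta>)"
      by (rule rate_le_compose[OF rate_le_F3 lim]) fact+
    show "rate_ge (tends_through ?S) real (\<lambda>p. F3 (real p) \<theta> \<beta>)"
      by (rule rate_ge_compose[OF rate_ge_F3 lim]) fact+
    show "rate_le (tends_through ?S) real (\<lambda>p. G3 p \<theta> \<beta>)"
      by (rule rate_le_mono[OF le], rule eventually_mono[OF eventually_in_tends_through])
        (use assms in \<open>auto intro: G3_le_F3\<close>)
  qed (fact | rule filterlim_real_tends_through)+
  show "log_asymp (tends_through {p. 0 < p \<and> D4 p a lam \<gamma> > 0}) real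
       (\<lambda>p. D4 p a lam \<gamma>) (\<lambda>p. B4 (real p) a lam \<gamma>)"
  proof (rule log_asympI)
    let ?S = "{p. 0 < p \<and> D4 p a lam \<gamma> > 0}"
    show lim: "filterlim real at_top (tends_through ?S)" by (rule filterlim_real_tends_through)
    show le: "rate_le (tends_through ?S) real (\<lambda>p. B4 (real p) a lam \<gamma>)"
      by (rule rate_le_compose[OF rate_le_B4 lim]) fact+
    show "rate_ge (tends_through ?S) real (\<lambda>p. B4 (real p) a lam \<gamma>)"
      by (rule rate_ge_compose[OF rate_ge_B4 lim]) fact+
    show "rate_le (tends_through ?S) real (\<lambda>p. D4 p a lam \<gamma>)"
      by (rule rate_le_mono[OF le], rule eventually_mono[OF eventually_in_tends_through])
        (use assms in \<open>auto intro: D4_le_B4\<close>)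
    show "rate_ge (tends_through ?S) real (\<lambda>p. D4 p a lam \<gamma>)"
      using rate_ge_D4[OF assms(1,2), of a] filter_leD[OF tends_through_le]
      unfolding rate_ge_def by blast
  qed
qed

end
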